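(* $\mathbf{JID}\subseteq\mathbf{Dms_2}$, but $\mathbf{JID}\not\subseteq\mathbf{Dms_1}$.
   Context: A semi-Heyting algebra is an algebra $\langle L,\vee,\wedge,\to,0,1\rangle$ such that $\langle L,\vee,\wedge,0,1\rangle$ is a bounded lattice and the identities $x\wedge(x\to y)\approx x\wedge y$, $x\wedge(y\to z)\approx x\wedge[(x\wedge y)\to(x\wedge z)]$, $x\to x\approx 1$ hold; write $x^*:=x\to 0$. A $\mathbf{DQD}$-algebra (dually quasi-De Morgan semi-Heyting algebra) is an algebra $\langle L,\vee,\wedge,\to,{}',0,1\rangle$ whose reduct $\langle L,\vee,\wedge,\to,0,1\rangle$ is a semi-Heyting algebra and which satisfies: $0'\approx 1$ and $1'\approx 0$; $(x\wedge y)'\approx x'\vee y'$; $(x\vee y)''\approx x''\vee y''$; $x''\le x$. $\mathbf{DQD}$ denotes the variety of all $\mathbf{DQD}$-algebras. $\mathbf{JID}$ is the subvariety of $\mathbf{DQD}$ defined by $x'\vee(y\to z)\approx(x'\vee y)\to(x'\vee z)$, and $\mathbf{Dms}$ is the subvariety of $\mathbf{DQD}$ defined by $(x\vee y)'\approx x'\wedge y'$. Levels: put $x^{(0)}:=x$ and $x^{(n+1)}:=((x^{(n)})')^*$; put $t_0(x):=x$ and $t_{n+1}(x):=t_n(x)\wedge x^{(n+1)}$. $\mathbf{DQD_n}$ is the subvariety of $\mathbf{DQD}$ defined by $t_n(x)\approx t_{n+1}(x)$, and for a subvariety $\mathbf{V}$ of $\mathbf{DQD}$, $\mathbf{V_n}:=\mathbf{V}\cap\mathbf{DQD_n}$.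 *)

theory Defs
  imports "HOL-Algebra.Congruence"
begin

text \<open>
  Algebras are records with an explicit carrier set, so that a variety is rendered as the set of all
  of its members whose carrier lies in a given type. Operations are unconstrained off the carrier.
  Since a failing identity already fails in a finitely generated, hence countable, subalgebra,
  non-inclusions between varieties can be stated over \<^typ>\<open>nat\<close> without loss of generality.
\<close>

record 'a semi_heyting = "'a partial_object" +
  sh_join :: "'a \<Rightarrow> 'a \<Rightarrow> 'a" (infixl \<open>\<squnion>\<index>\<close> 65)
  sh_meet :: "'a \<Rightarrow> 'a \<Rightarrow> 'a" (infixl \<open>\<sqinter>\<index>\<close> 70)
  sh_imp :: "'a \<Rightarrow> 'a \<Rightarrow> 'a" (infixr \<open>\<rightarrow>\<index>\<close> 60)
  sh_zero :: 'a (\<open>\<zero>\<index>\<close>)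
  sh_one :: 'a (\<open>\<one>\<index>\<close>)

record 'a dqd = "'a semi_heyting" +
  dqd_neg :: "'a \<Rightarrow> 'a" (\<open>\<sim>\<index> _\<close> [81] 80)

locale bounded_lattice_algebra =
  fixes L :: "('a, 'm) semi_heyting_scheme" (structure)
  assumes join_closed: "\<lbrakk>x \<in> carrier L; y \<in> carrier L\<rbrakk> \<Longrightarrow> x \<squnion> y \<in> carrier L"
    and meet_closed: "\<lbrakk>x \<in> carrier L; y \<in> carrier L\<rbrakk> \<Longrightarrow> x \<sqinter> y \<in> carrier L"
    and zero_closed: "\<zero> \<in> carrier L"
    and one_closed: "\<one> \<in> carrier L"
    and join_commute: "\<lbrakk>x \<in> carrier L; y \<in> carrier L\<rbrakk> \<Longrightarrow> x \<squnion> y = y \<squnion> x"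
    and meet_commute: "\<lbrakk>x \<in> carrier L; y \<in> carrier L\<rbrakk> \<Longrightarrow> x \<sqinter> y = y \<sqinter> x"
    and join_assoc: "\<lbrakk>x \<in> carrier L; y \<in> carrier L; z \<in> carrier L\<rbrakk>
      \<Longrightarrow> (x \<squnion> y) \<squnion> z = x \<squnion> (y \<squnion> z)"
    and meet_assoc: "\<lbrakk>x \<in> carrier L; y \<in> carrier L; z \<in> carrier L\<rbrakk>
      \<Longrightarrow> (x \<sqinter> y) \<sqinter> z = x \<sqinter> (y \<sqinter> z)"
    and join_absorb: "\<lbrakk>x \<in> carrier L; y \<in> carrier L\<rbrakk> \<Longrightarrow> x \<squnion> (x \<sqinter> y) = x"
    and meet_absorb: "\<lbrakk>x \<in> carrier L; y \<in> carrier L\<rbrakk> \<Longrightarrow> x \<sqinter> (x \<squnion> y) = x"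
    and zero_join: "x \<in> carrier L \<Longrightarrow> \<zero> \<squnion> x = x"
    and one_meet: "x \<in> carrier L \<Longrightarrow> \<one> \<sqinter> x = x"

locale semi_heyting_algebra = bounded_lattice_algebra +
  assumes imp_closed: "\<lbrakk>x \<in> carrier L; y \<in> carrier L\<rbrakk> \<Longrightarrow> x \<rightarrow> y \<in> carrier L"
    and meet_imp: "\<lbrakk>x \<in> carrier L; y \<in> carrier L\<rbrakk> \<Longrightarrow> x \<sqinter> (x \<rightarrow> y) = x \<sqinter> y"
    and meet_imp_distrib: "\<lbrakk>x \<in> carrier L; y \<in> carrier L; z \<in> carrier L\<rbrakk>
      \<Longrightarrow> x \<sqinter> (y \<rightarrow> z) = x \<sqinter> ((x \<sqinter> y) \<rightarrow> (x \<sqinter> z))"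
    and imp_self: "x \<in> carrier L \<Longrightarrow> x \<rightarrow> x = \<one>"

definition sh_star :: "('a, 'm) semi_heyting_scheme \<Rightarrow> 'a \<Rightarrow> 'a" where
  "sh_star L x = x \<rightarrow>\<^bsub>L\<^esub> \<zero>\<^bsub>L\<^esub>"

text \<open>The inequality \<open>x'' \<le> x\<close> refers to the lattice order, i.e. it abbreviates \<open>x'' \<sqinter> x = x''\<close>.\<close>

locale dqd_algebra = semi_heyting_algebra L
  for L :: "('a, 'm) dqd_scheme" (structure) +
  assumes neg_closed: "x \<in> carrier L \<Longrightarrow> \<sim> x \<in> carrier L"
    and neg_zero: "\<sim> \<zero> = \<one>"
    and neg_one: "\<sim> \<one> = \<zero>"
    and neg_meet: "\<lbrakk>x \<in> carrier L; y \<in> carrier L\<rbrakk> \<Longrightarrow> \<sim> (x \<sqinter> y) = \<sim> x \<squnion> \<sim> y"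
    and neg_neg_join: "\<lbrakk>x \<in> carrier L; y \<in> carrier L\<rbrakk>
      \<Longrightarrow> \<sim> (\<sim> (x \<squnion> y)) = \<sim> (\<sim> x) \<squnion> \<sim> (\<sim> y)"
    and neg_neg_le: "x \<in> carrier L \<Longrightarrow> \<sim> (\<sim> x) \<sqinter> x = \<sim> (\<sim> x)"

definition DQD :: "'a dqd set" where
  "DQD = {L. dqd_algebra L}"

definition JID :: "'a dqd set" where
  "JID = {L \<in> DQD. \<forall>x \<in> carrier L. \<forall>y \<in> carrier L. \<forall>z \<in> carrier L.
    \<sim>\<^bsub>L\<^esub> x \<squnion>\<^bsub>L\<^esub> (y \<rightarrow>\<^bsub>L\<^esub> z) = (\<sim>\<^bsub>L\<^esub> x \<squnion>\<^bsub>L\<^esub> y) \<rightarrow>\<^bsub>L\<^esub> (\<sim>\<^bsub>L\<^esub> x \<squnion>\<^bsub>L\<^esub> z)}"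

definition Dms :: "'a dqd set" where
  "Dms = {L \<in> DQD. \<forall>x \<in> carrier L. \<forall>y \<in> carrier L.
    \<sim>\<^bsub>L\<^esub> (x \<squnion>\<^bsub>L\<^esub> y) = \<sim>\<^bsub>L\<^esub> x \<sqinter>\<^bsub>L\<^esub> \<sim>\<^bsub>L\<^esub> y}"

primrec neg_star_iter :: "('a, 'm) dqd_scheme \<Rightarrow> nat \<Rightarrow> 'a \<Rightarrow> 'a" where
  "neg_star_iter L 0 x = x"
| "neg_star_iter L (Suc n) x = sh_star L (\<sim>\<^bsub>L\<^esub> (neg_star_iter L n x))"

primrec level_term :: "('a, 'm) dqd_scheme \<Rightarrow> nat \<Rightarrow> 'a \<Rightarrow> 'a" where
  "level_term L 0 x = x"
| "level_term L (Suc n) x = level_term L n x \<sqinter>\<^bsub>L\<^esub> neg_star_iter L (Suc n) x"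

definition DQD_level :: "nat \<Rightarrow> 'a dqd set" where
  "DQD_level n = {L \<in> DQD. \<forall>x \<in> carrier L. level_term L n x = level_term L (Suc n) x}"

definition at_level :: "'a dqd set \<Rightarrow> nat \<Rightarrow> 'a dqd set" where
  "at_level V n = V \<inter> DQD_level n"

end

theory Submission
  imports Defs
begin

text \<open>
  Taking \<open>y = x'\<close> and \<open>z = 0\<close> in the identity defining \<open>JID\<close> gives
  \<open>x' \<or> x'\<^sup>* = x' \<rightarrow> x' = 1\<close>, so every element \<open>x'\<close> is complemented, with complement
  \<open>x'\<^sup>*\<close>. In every \<open>DQD\<close>-algebra a complemented element \<open>u\<close> satisfies \<open>u'' = u\<close>: if \<open>v\<close> is its
  complement then \<open>u'' \<or> v'' = (u \<or> v)'' = 1\<close> with \<open>u'' \<le> u\<close> and \<open>v'' \<le> v\<close>, and the lattice is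
  distributive. Hence \<open>x''' = x'\<close>, and likewise \<open>x' \<and> y'\<close> is complemented, so that
  \<open>x' \<and> y' = (x' \<and> y')'' = (x'' \<or> y'')' = (x \<or> y)''' = (x \<or> y)'\<close>, which is membership in \<open>Dms\<close>.
  Now the operation \<open>'\<close> maps complementary pairs to complementary pairs, whence \<open>x'\<^sup>*'\<^sup>* = x''\<close> and
  \<open>x'\<^sup>*'\<^sup>*'\<^sup>* = x'''\<^sup>* = x'\<^sup>*\<close>: the iterates of \<open>x \<mapsto> x'\<^sup>*\<close> have period two from the first one on,
  and the level terms are constant from \<open>t\<^sub>2\<close> on.

  For the non-inclusion, the product of the two-element and the three-element Heyting chains carries
  an operation \<open>'\<close> that exchanges the Boolean parts of the factors; its values are Boolean, so the
  identity of \<open>JID\<close> holds, but \<open>t\<^sub>1(x) \<noteq> t\<^sub>2(x)\<close> for \<open>x = (1, e)\<close> with \<open>e\<close> the middle element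
  of the three-element chain.
\<close>

section \<open>Bounded lattices\<close>

context bounded_lattice_algebra
begin

text \<open>The lattice order.\<close>

definition le :: "'a \<Rightarrow> 'a \<Rightarrow> bool" (infix \<open>\<preceq>\<close> 50) where
  "x \<preceq> y \<longleftrightarrow> x \<sqinter> y = x"

text \<open>Complementary pairs; membership in the carrier is part of the notion.\<close>

definition complementary :: "'a \<Rightarrow> 'a \<Rightarrow> bool" where
  "complementary u v \<longleftrightarrow> u \<in> carrier L \<and> v \<in> carrier L \<and> u \<sqinter> v = \<zero> \<and> u \<squnion> v = \<one>"

lemmas closed = join_closed meet_closed zero_closed one_closed

lemma meet_idem: "x \<in> carrier L \<Longrightarrow> x \<sqinter> x = x"
  by (metis join_absorb meet_absorb meet_closed)

lemma zero_meet: "x \<in> carrier L \<Longrightarrow> \<zero> \<sqinter> x = \<zero>"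
  by (metis meet_absorb zero_closed zero_join)

lemma meet_zero: "x \<in> carrier L \<Longrightarrow> x \<sqinter> \<zero> = \<zero>"
  by (metis meet_commute zero_closed zero_meet)

lemma join_zero: "x \<in> carrier L \<Longrightarrow> x \<squnion> \<zero> = x"
  by (metis join_commute zero_closed zero_join)

lemma meet_one: "x \<in> carrier L \<Longrightarrow> x \<sqinter> \<one> = x"
  by (metis meet_commute one_closed one_meet)

lemma join_one: "x \<in> carrier L \<Longrightarrow> x \<squnion> \<one> = \<one>"
  by (metis join_absorb join_commute meet_closed one_closed one_meet)

lemma one_join: "x \<in> carrier L \<Longrightarrow> \<one> \<squnion> x = \<one>"
  by (metis join_commute join_one one_closed)

lemma le_iff_join: "\<lbrakk>x \<in> carrier L; y \<in> carrier L\<rbrakk> \<Longrightarrow> x \<preceq> y \<longleftrightarrow> x \<squnion> y = y"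
  unfolding le_def by (metis join_absorb join_commute meet_absorb meet_commute)

lemma le_antisym: "\<lbrakk>x \<in> carrier L; y \<in> carrier L; x \<preceq> y; y \<preceq> x\<rbrakk> \<Longrightarrow> x = y"
  unfolding le_def by (metis meet_commute)

lemma le_trans:
  "\<lbrakk>x \<in> carrier L; y \<in> carrier L; z \<in> carrier L; x \<preceq> y; y \<preceq> z\<rbrakk> \<Longrightarrow> x \<preceq> z"
  unfolding le_def by (metis meet_assoc)

lemma join_upper1: "\<lbrakk>x \<in> carrier L; y \<in> carrier L\<rbrakk> \<Longrightarrow> x \<preceq> x \<squnion> y"
  by (simp add: le_def meet_absorb)

lemma join_upper2: "\<lbrakk>x \<in> carrier L; y \<in> carrier L\<rbrakk> \<Longrightarrow> y \<preceq> x \<squnion> y"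
  by (metis join_commute join_upper1)

lemma join_least:
  "\<lbrakk>x \<in> carrier L; y \<in> carrier L; z \<in> carrier L; x \<preceq> z; y \<preceq> z\<rbrakk> \<Longrightarrow> x \<squnion> y \<preceq> z"
  by (simp add: le_iff_join join_assoc join_closed)

lemma meet_lower1: "\<lbrakk>x \<in> carrier L; y \<in> carrier L\<rbrakk> \<Longrightarrow> x \<sqinter> y \<preceq> x"
  unfolding le_def by (metis meet_assoc meet_closed meet_commute meet_idem)

lemma meet_lower2: "\<lbrakk>x \<in> carrier L; y \<in> carrier L\<rbrakk> \<Longrightarrow> x \<sqinter> y \<preceq> y"
  by (metis meet_commute meet_lower1)

lemma meet_greatest:
  "\<lbrakk>x \<in> carrier L; y \<in> carrier L; z \<in> carrier L; z \<preceq> x; z \<preceq> y\<rbrakk> \<Longrightarrow> z \<preceq> x \<sqinter> y"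
  unfolding le_def by (metis meet_assoc)

lemma complementary_sym: "complementary u v \<Longrightarrow> complementary v u"
  unfolding complementary_def by (metis join_commute meet_commute)

end

section \<open>Distributivity and complements in semi-Heyting algebras\<close>

context semi_heyting_algebra
begin

text \<open>
  The map \<open>y \<mapsto> x \<rightarrow> (x \<and> y)\<close> is the residual of \<open>y \<mapsto> x \<and> y\<close>, although \<open>\<rightarrow>\<close> itself need not
  be a Heyting implication.
\<close>

lemma residuation:
  assumes [simp]: "x \<in> carrier L" "y \<in> carrier L" "z \<in> carrier L"
  shows "x \<sqinter> z \<preceq> y \<longleftrightarrow> z \<preceq> x \<rightarrow> (x \<sqinter> y)"
proof
  assume "x \<sqinter> z \<preceq> y"
  then have "z \<sqinter> (x \<sqinter> y) = z \<sqinter> x"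
    unfolding le_def by (metis assms meet_assoc meet_commute)
  then show "z \<preceq> x \<rightarrow> (x \<sqinter> y)"
    unfolding le_def
    using meet_imp_distrib[of z x "x \<sqinter> y"] by (simp add: meet_closed imp_self meet_one)
next
  assume "z \<preceq> x \<rightarrow> (x \<sqinter> y)"
  then have "x \<sqinter> z = (x \<sqinter> (x \<rightarrow> (x \<sqinter> y))) \<sqinter> z"
    unfolding le_def by (metis assms imp_closed meet_assoc meet_closed meet_commute)
  also have "\<dots> = (x \<sqinter> z) \<sqinter> y"
    by (simp add: meet_imp meet_closed)
      (metis assms meet_assoc meet_closed meet_commute meet_idem)
  finally show "x \<sqinter> z \<preceq> y"
    by (simp add: le_def)
qed

lemma meet_join_distrib:
  assumes [simp]: "x \<in> carrier L" "y \<in> carrier L" "z \<in> carrier L"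
  shows "x \<sqinter> (y \<squnion> z) = (x \<sqinter> y) \<squnion> (x \<sqinter> z)"
proof (rule le_antisym)
  let ?d = "(x \<sqinter> y) \<squnion> (x \<sqinter> z)"
  note [simp] = closed imp_closed
  show "x \<sqinter> (y \<squnion> z) \<preceq> ?d"
  proof -
    have "y \<preceq> x \<rightarrow> (x \<sqinter> ?d)" "z \<preceq> x \<rightarrow> (x \<sqinter> ?d)"
      by (simp_all flip: residuation add: join_upper1 join_upper2)
    then have "y \<squnion> z \<preceq> x \<rightarrow> (x \<sqinter> ?d)"
      by (simp add: join_least)
    then show ?thesis
      by (simp add: residuation)
  qed
  have "x \<sqinter> y \<preceq> y \<squnion> z" "x \<sqinter> z \<preceq> y \<squnion> z"
    by (rule le_trans[of _ y] le_trans[of _ z]; simp add: meet_lower2 join_upper1 join_upper2)+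
  then show "?d \<preceq> x \<sqinter> (y \<squnion> z)"
    by (simp add: join_least meet_greatest meet_lower1)
qed (simp_all add: closed)

lemma star_closed: "x \<in> carrier L \<Longrightarrow> sh_star L x \<in> carrier L"
  by (simp add: sh_star_def imp_closed zero_closed)

lemma meet_star: "x \<in> carrier L \<Longrightarrow> x \<sqinter> sh_star L x = \<zero>"
  by (simp add: sh_star_def meet_imp meet_zero zero_closed)

lemma complementary_unique:
  assumes "complementary u v" and "complementary u w"
  shows "v = w"
proof -
  have "v \<preceq> w" if "complementary u v" "complementary u w" for v w
  proof -
    have [simp]: "u \<in> carrier L" "v \<in> carrier L" "w \<in> carrier L"
      using that by (auto simp: complementary_def)
    have "v = v \<sqinter> (u \<squnion> w)"
      using that by (simp add: complementary_def meet_one)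
    also have "\<dots> = (v \<sqinter> u) \<squnion> (v \<sqinter> w)"
      by (simp add: meet_join_distrib)
    also have "\<dots> = v \<sqinter> w"
      using complementary_sym[OF that(1)] by (simp add: complementary_def zero_join meet_closed)
    finally show ?thesis
      by (simp add: le_def)
  qed
  then show ?thesis
    using assms by (meson complementary_def le_antisym)
qed

lemma star_eq_complement:
  assumes "complementary u v"
  shows "sh_star L u = v"
proof -
  have [simp]: "u \<in> carrier L" "v \<in> carrier L"
    using assms by (auto simp: complementary_def)
  have "v \<preceq> sh_star L u"
    using residuation[of u \<zero> v] assms
    by (simp add: complementary_def sh_star_def zero_closed meet_zero meet_idem le_def)
  then have "v \<squnion> sh_star L u = sh_star L u"
    by (simp add: le_iff_join star_closed)
  then have "u \<squnion> sh_star L u = (u \<squnion> v) \<squnion> sh_star L u"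
    by (simp add: join_assoc star_closed)
  then have "u \<squnion> sh_star L u = \<one>"
    using assms by (simp add: complementary_def one_join star_closed)
  then have "complementary u (sh_star L u)"
    by (simp add: complementary_def star_closed meet_star)
  then show ?thesis
    using assms complementary_unique by blast
qed

lemma complementary_meet:
  assumes "complementary u v" and "complementary w z"
  shows "complementary (u \<sqinter> w) (v \<squnion> z)"
proof -
  have [simp]: "u \<in> carrier L" "v \<in> carrier L" "w \<in> carrier L" "z \<in> carrier L"
    using assms by (auto simp: complementary_def)
  note [simp] = closed
  have "(u \<sqinter> w) \<sqinter> v = \<zero>" "(u \<sqinter> w) \<sqinter> z = \<zero>"
    using assms unfolding complementary_def
    by (metis meet_assoc meet_commute meet_zero)+
  then have "(u \<sqinter> w) \<sqinter> (v \<squnion> z) = \<zero>"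
    by (simp add: meet_join_distrib zero_join)
  moreover have "(u \<sqinter> w) \<squnion> (v \<squnion> z) = \<one>"
  proof -
    have "u = (u \<sqinter> w) \<squnion> (u \<sqinter> z)"
      using assms(2) by (simp flip: meet_join_distrib add: complementary_def meet_one)
    moreover have "(u \<sqinter> z) \<squnion> z = z"
      using meet_lower2[of u z] by (simp add: le_iff_join)
    ultimately have "(u \<sqinter> w) \<squnion> (v \<squnion> z) = (u \<squnion> v) \<squnion> z"
      by (smt (verit) join_assoc join_closed join_commute meet_closed
          \<open>u \<in> carrier L\<close> \<open>v \<in> carrier L\<close> \<open>w \<in> carrier L\<close> \<open>z \<in> carrier L\<close>)
    then show ?thesis
      using assms(1) by (simp add: complementary_def one_join)
  qed
  ultimately show ?thesis
    by (simp add: complementary_def)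
qed

end

section \<open>Complemented elements in dually quasi-De Morgan algebras\<close>

lemma (in dqd_algebra) neg_neg_complemented:
  assumes "complementary u v"
  shows "\<sim> (\<sim> u) = u"
proof -
  have [simp]: "u \<in> carrier L" "v \<in> carrier L"
    using assms by (auto simp: complementary_def)
  note [simp] = closed neg_closed
  have "\<sim> (\<sim> u) \<squnion> \<sim> (\<sim> v) = \<one>"
    using assms by (simp flip: neg_neg_join add: complementary_def neg_one neg_zero)
  then have "u = u \<sqinter> (\<sim> (\<sim> u) \<squnion> \<sim> (\<sim> v))"
    by (simp add: meet_one)
  also have "\<dots> = (u \<sqinter> \<sim> (\<sim> u)) \<squnion> (u \<sqinter> \<sim> (\<sim> v))"
    by (simp add: meet_join_distrib)
  also have "u \<sqinter> \<sim> (\<sim> u) = \<sim> (\<sim> u)"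
    by (metis \<open>u \<in> carrier L\<close> meet_commute neg_closed neg_neg_le)
  also have "u \<sqinter> \<sim> (\<sim> v) = \<zero>"
  proof -
    have "u \<sqinter> \<sim> (\<sim> v) = u \<sqinter> (v \<sqinter> \<sim> (\<sim> v))"
      by (metis \<open>v \<in> carrier L\<close> meet_commute neg_closed neg_neg_le)
    also have "\<dots> = \<zero>"
      using assms by (simp flip: meet_assoc add: complementary_def zero_meet)
    finally show ?thesis .
  qed
  finally show ?thesis
    by (simp add: join_zero)
qed

text \<open>A member of \<open>JID\<close>, as a locale.\<close>

locale jid_algebra = dqd_algebra +
  assumes neg_join_imp: "\<lbrakk>x \<in> carrier L; y \<in> carrier L; z \<in> carrier L\<rbrakk>
      \<Longrightarrow> \<sim> x \<squnion> (y \<rightarrow> z) = (\<sim> x \<squnion> y) \<rightarrow> (\<sim> x \<squnion> z)"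
begin

lemma complementary_neg_star:
  assumes "x \<in> carrier L"
  shows "complementary (\<sim> x) (sh_star L (\<sim> x))"
proof -
  have "\<sim> x \<squnion> \<sim> x = \<sim> x"
    using assms by (metis meet_idem neg_meet)
  then have "\<sim> x \<squnion> sh_star L (\<sim> x) = \<one>"
    using neg_join_imp[of x "\<sim> x" \<zero>] assms
    by (simp add: sh_star_def closed neg_closed join_zero imp_self)
  then show ?thesis
    using assms by (simp add: complementary_def meet_star star_closed neg_closed)
qed

lemma neg_neg_neg: "x \<in> carrier L \<Longrightarrow> \<sim> (\<sim> (\<sim> x)) = \<sim> x"
  by (meson complementary_neg_star neg_neg_complemented)

lemma neg_join:
  assumes [simp]: "x \<in> carrier L" "y \<in> carrier L"
  shows "\<sim> (x \<squnion> y) = \<sim> x \<sqinter> \<sim> y"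
proof -
  note [simp] = closed neg_closed
  have "\<sim> x \<sqinter> \<sim> y = \<sim> (\<sim> (\<sim> x \<sqinter> \<sim> y))"
    by (metis assms complementary_meet complementary_neg_star neg_neg_complemented)
  also have "\<dots> = \<sim> (\<sim> (\<sim> (x \<squnion> y)))"
    by (simp add: neg_meet neg_neg_join)
  also have "\<dots> = \<sim> (x \<squnion> y)"
    by (simp add: neg_neg_neg)
  finally show ?thesis ..
qed

lemma complementary_neg: "complementary u v \<Longrightarrow> complementary (\<sim> u) (\<sim> v)"
  unfolding complementary_def
  by (metis neg_closed neg_join neg_meet neg_one neg_zero)

lemma neg_star_neg_star:
  assumes "x \<in> carrier L"
  shows "sh_star L (\<sim> (sh_star L (\<sim> x))) = \<sim> (\<sim> x)"
  using assms
  by (intro star_eq_complement complementary_sym[OF complementary_neg] complementary_neg_star)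

lemma level_term_stable:
  assumes [simp]: "x \<in> carrier L"
  shows "level_term L 2 x = level_term L (Suc 2) x"
proof -
  note [simp] = closed neg_closed star_closed
  let ?c = "sh_star L (\<sim> x)" and ?d = "\<sim> (\<sim> x)"
  have "(x \<sqinter> ?c) \<sqinter> ?d = ((x \<sqinter> ?c) \<sqinter> ?d) \<sqinter> ?c"
    by (smt (verit) assms meet_assoc meet_closed meet_commute meet_idem neg_closed star_closed)
  then show ?thesis
    by (simp add: eval_nat_numeral neg_star_neg_star neg_neg_neg)
qed

end

lemma JID_iff: "L \<in> JID \<longleftrightarrow> jid_algebra L"
  by (auto simp: JID_def DQD_def jid_algebra_def jid_algebra_axioms_def)

lemma JID_subset: "JID \<subseteq> at_level Dms 2"
proof
  fix L :: "'a dqd"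
  assume "L \<in> JID"
  then interpret jid_algebra L
    by (simp add: JID_iff)
  have "L \<in> DQD"
    by (simp add: DQD_def dqd_algebra_axioms)
  then show "L \<in> at_level Dms 2"
    by (auto simp only: at_level_def Dms_def DQD_level_def neg_join level_term_stable)
qed

section \<open>A six-element member of \<open>JID\<close> outside level one\<close>

text \<open>
  The product of the Heyting chains \<open>{0 < 1}\<close> and \<open>{0 < 1 < 2}\<close>, the pair \<open>(p, q)\<close> being coded as
  \<open>3 p + q\<close>. The operation \<open>'\<close> sends \<open>(p, q)\<close> to \<open>(q\<^sup>+, p\<^sup>+)\<close>, where \<open>\<^sup>+\<close> sends the top of a chain
  to the bottom of the other chain and every other element to the top of the other chain.
\<close>

definition six :: "nat dqd" where
  "six = \<lparr>carrier = {0..<6},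
    sh_join = (\<lambda>x y. 3 * max (x div 3) (y div 3) + max (x mod 3) (y mod 3)),
    sh_meet = (\<lambda>x y. 3 * min (x div 3) (y div 3) + min (x mod 3) (y mod 3)),
    sh_imp = (\<lambda>x y. 3 * (if x div 3 \<le> y div 3 then 1 else y div 3)
      + (if x mod 3 \<le> y mod 3 then 2 else y mod 3)),
    sh_zero = 0, sh_one = 5,
    dqd_neg = (\<lambda>x. 3 * (if x mod 3 = 2 then 0 else 1) + (if x div 3 = 1 then 0 else 2))\<rparr>"

lemma six_JID: "six \<in> JID"
proof -
  have nullary: "\<zero>\<^bsub>six\<^esub> \<in> carrier six" "\<one>\<^bsub>six\<^esub> \<in> carrier six"
      "\<sim>\<^bsub>six\<^esub> \<zero>\<^bsub>six\<^esub> = \<one>\<^bsub>six\<^esub>" "\<sim>\<^bsub>six\<^esub> \<one>\<^bsub>six\<^esub> = \<zero>\<^bsub>six\<^esub>"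
    by code_simp+
  have unary: "\<forall>x \<in> carrier six. \<sim>\<^bsub>six\<^esub> x \<in> carrier six
      \<and> \<zero>\<^bsub>six\<^esub> \<squnion>\<^bsub>six\<^esub> x = x \<and> \<one>\<^bsub>six\<^esub> \<sqinter>\<^bsub>six\<^esub> x = x \<and> x \<rightarrow>\<^bsub>six\<^esub> x = \<one>\<^bsub>six\<^esub>
      \<and> \<sim>\<^bsub>six\<^esub> (\<sim>\<^bsub>six\<^esub> x) \<sqinter>\<^bsub>six\<^esub> x = \<sim>\<^bsub>six\<^esub> (\<sim>\<^bsub>six\<^esub> x)"
    by code_simp
  have binary: "\<forall>x \<in> carrier six. \<forall>y \<in> carrier six.
      x \<squnion>\<^bsub>six\<^esub> y \<in> carrier six \<and> x \<sqinter>\<^bsub>six\<^esub> y \<in> carrier six \<and> x \<rightarrow>\<^bsub>six\<^esub> y \<in> carrier six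
      \<and> x \<squnion>\<^bsub>six\<^esub> y = y \<squnion>\<^bsub>six\<^esub> x \<and> x \<sqinter>\<^bsub>six\<^esub> y = y \<sqinter>\<^bsub>six\<^esub> x
      \<and> x \<squnion>\<^bsub>six\<^esub> (x \<sqinter>\<^bsub>six\<^esub> y) = x \<and> x \<sqinter>\<^bsub>six\<^esub> (x \<squnion>\<^bsub>six\<^esub> y) = x
      \<and> x \<sqinter>\<^bsub>six\<^esub> (x \<rightarrow>\<^bsub>six\<^esub> y) = x \<sqinter>\<^bsub>six\<^esub> y
      \<and> \<sim>\<^bsub>six\<^esub> (x \<sqinter>\<^bsub>six\<^esub> y) = \<sim>\<^bsub>six\<^esub> x \<squnion>\<^bsub>six\<^esub> \<sim>\<^bsub>six\<^esub> y
      \<and> \<sim>\<^bsub>six\<^esub> (\<sim>\<^bsub>six\<^esub> (x \<squnion>\<^bsub>six\<^esub> y)) = \<sim>\<^bsub>six\<^esub> (\<sim>\<^bsub>six\<^esub> x) \<squnion>\<^bsub>six\<^esub> \<sim>\<^bsub>six\<^esub> (\<sim>\<^bsub>six\<^esub> y)"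
    by code_simp
  have ternary: "\<forall>x \<in> carrier six. \<forall>y \<in> carrier six. \<forall>z \<in> carrier six.
      (x \<squnion>\<^bsub>six\<^esub> y) \<squnion>\<^bsub>six\<^esub> z = x \<squnion>\<^bsub>six\<^esub> (y \<squnion>\<^bsub>six\<^esub> z)
      \<and> (x \<sqinter>\<^bsub>six\<^esub> y) \<sqinter>\<^bsub>six\<^esub> z = x \<sqinter>\<^bsub>six\<^esub> (y \<sqinter>\<^bsub>six\<^esub> z)
      \<and> x \<sqinter>\<^bsub>six\<^esub> (y \<rightarrow>\<^bsub>six\<^esub> z) = x \<sqinter>\<^bsub>six\<^esub> ((x \<sqinter>\<^bsub>six\<^esub> y) \<rightarrow>\<^bsub>six\<^esub> (x \<sqinter>\<^bsub>six\<^esub> z))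
      \<and> \<sim>\<^bsub>six\<^esub> x \<squnion>\<^bsub>six\<^esub> (y \<rightarrow>\<^bsub>six\<^esub> z) = (\<sim>\<^bsub>six\<^esub> x \<squnion>\<^bsub>six\<^esub> y) \<rightarrow>\<^bsub>six\<^esub> (\<sim>\<^bsub>six\<^esub> x \<squnion>\<^bsub>six\<^esub> z)"
    by code_simp
  show ?thesis
    unfolding JID_iff
    by unfold_locales (use nullary unary binary ternary in blast)+
qed

lemma six_not_level_1: "six \<notin> DQD_level 1"
proof -
  \<comment> \<open>\<open>4\<close> codes the pair of the top of the first chain and the middle element of the second.\<close>
  have "4 \<in> carrier six" and "level_term six 1 4 \<noteq> level_term six (Suc 1) 4"
    by code_simp+
  then show ?thesis
    unfolding DQD_level_def by blast
qed

theorem theorem3p10: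
  shows "(JID :: 'a dqd set) \<subseteq> at_level Dms 2 \<and> \<not> (JID :: nat dqd set) \<subseteq> at_level Dms 1"
  using JID_subset six_JID six_not_level_1 by (auto simp: at_level_def)

end
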